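(* Suppose that $X$ has no isolated point. Let $(X,f_{1,\infty})$ be a non-autonomous discrete system with $f_{1,\infty}$ feeble open and surjective and converging uniformly to a map $f$. If $\{f_n^{n+k}\}_{k\in\mathbb{N}}$ converges collectively to $\{f^k\}_{k\in\mathbb{N}}$, then $(X,f)$ is minimal if and only if $(X,f_{1,\infty})$ is minimal.
   Context: $\mathbb{N}=\{1,2,3,\dots\}$. A non-autonomous discrete system $(X,f_{1,\infty})$ consists of a compact metric space $(X,d)$ and a sequence $f_{1,\infty}=\{f_n\}_{n=1}^\infty$ of continuous maps $f_n:X\to X$. For $i,n\in\mathbb{N}$, $f_i^n:=f_{i+(n-1)}\circ\cdots\circ f_i$ (a composition of $n$ maps), and $f_i^0=id_X$. The autonomous system $(X,f)$ is the special case $f_n=f$ for all $n$. Uniform convergence of $f_{1,\infty}$ to $f:X\to X$ means $D(f_n,f)\to 0$, where $D(g,h)=\sup_{x\in X}d(g(x),h(x))$. "$\{f_n^{n+k}\}_{k\in\mathbb{N}}$ converges collectively to $\{f^k\}_{k\in\mathbb{N}}$" means: for every $\varepsilon>0$ there exists $r_0\in\mathbb{N}$ such that $D(f_r^k,f^k)<\varepsilon$ for all $r\ge r_0$ and all $k\in\mathbb{N}$, where $f_r^k=f_{r+k-1}\circ\cdots\circ f_r$ and $f^k$ is the $k$-fold composition of $f$. $f_{1,\infty}$ is surjective if every $f_i$ is surjective. It is feeble open if $\mathrm{int}(f_i(U))\neq\emptyset$ for every nonempty open $U\subseteq X$ and every $i\in\mathbb{N}$. The system $(X,f_{1,\infty})$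 is minimal if for every $x\in X$ the orbit $\{x,f_1^1(x),f_1^2(x),\dots\}$ is dense in $X$. *)

theory Defs
  imports "HOL-Analysis.Analysis"
begin

text \<open>
  The space is a set \<open>X\<close> in a metric space type, carrying the induced metric and the subspace
  topology \<open>top_of_set X\<close>; interior and density are taken relative to \<open>X\<close>. Maps
  \<open>X \<rightarrow> X\<close> are total functions of which only the values on \<open>X\<close> matter. Sequences of maps are
  indexed from 1; the entry \<open>F 0\<close> is never constrained and never enters an orbit.
\<close>

definition nads :: "'a::metric_space set \<Rightarrow> (nat \<Rightarrow> 'a \<Rightarrow> 'a) \<Rightarrow> bool" where
  "nads X F \<longleftrightarrow> compact X \<and> (\<forall>n\<ge>1. F n \<in> X \<rightarrow> X \<and> continuous_on X (F n))"

text \<open>\<open>ncomp F i n\<close> is \<open>F (i + n - 1) \<circ> \<dots> \<circ> F i\<close>, a composition of \<open>n\<close> maps.\<close>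

primrec ncomp :: "(nat \<Rightarrow> 'a \<Rightarrow> 'a) \<Rightarrow> nat \<Rightarrow> nat \<Rightarrow> 'a \<Rightarrow> 'a" where
  "ncomp F i 0 = id"
| "ncomp F i (Suc n) = F (i + n) \<circ> ncomp F i n"

text \<open>For \<open>X\<close> compact and nonempty and \<open>g\<close>, \<open>h\<close> mapping \<open>X\<close> into itself, the supremum is over
  a nonempty bounded set, hence the true one.\<close>

definition sup_dist :: "'a::metric_space set \<Rightarrow> ('a \<Rightarrow> 'a) \<Rightarrow> ('a \<Rightarrow> 'a) \<Rightarrow> real" where
  "sup_dist X g h = (SUP x\<in>X. dist (g x) (h x))"

definition converges_uniformly ::
  "'a::metric_space set \<Rightarrow> (nat \<Rightarrow> 'a \<Rightarrow> 'a) \<Rightarrow> ('a \<Rightarrow> 'a) \<Rightarrow> bool" where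
  "converges_uniformly X F f \<longleftrightarrow> (\<lambda>n. sup_dist X (F n) f) \<longlonglongrightarrow> 0"

definition converges_collectively ::
  "'a::metric_space set \<Rightarrow> (nat \<Rightarrow> 'a \<Rightarrow> 'a) \<Rightarrow> ('a \<Rightarrow> 'a) \<Rightarrow> bool" where
  "converges_collectively X F f \<longleftrightarrow>
    (\<forall>\<epsilon>>0. \<exists>r0\<ge>1. \<forall>r\<ge>r0. \<forall>k\<ge>1. sup_dist X (ncomp F r k) (f ^^ k) < \<epsilon>)"

definition nads_surjective :: "'a set \<Rightarrow> (nat \<Rightarrow> 'a \<Rightarrow> 'a) \<Rightarrow> bool" where
  "nads_surjective X F \<longleftrightarrow> (\<forall>i\<ge>1. F i ` X = X)"

definition nads_feeble_open :: "'a::metric_space set \<Rightarrow> (nat \<Rightarrow> 'a \<Rightarrow> 'a) \<Rightarrow> bool" where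
  "nads_feeble_open X F \<longleftrightarrow>
    (\<forall>i\<ge>1. \<forall>U. openin (top_of_set X) U \<and> U \<noteq> {} \<longrightarrow>
      (top_of_set X) interior_of (F i ` U) \<noteq> {})"

definition nads_orbit :: "(nat \<Rightarrow> 'a \<Rightarrow> 'a) \<Rightarrow> 'a \<Rightarrow> 'a set" where
  "nads_orbit F x = range (\<lambda>n. ncomp F 1 n x)"

definition nads_minimal :: "'a::metric_space set \<Rightarrow> (nat \<Rightarrow> 'a \<Rightarrow> 'a) \<Rightarrow> bool" where
  "nads_minimal X F \<longleftrightarrow> (\<forall>x\<in>X. (top_of_set X) closure_of (nads_orbit F x) = X)"

end

theory Submission
  imports Defs
begin

text \<open>
  Since \<open>X\<close> has no isolated point, a dense orbit visits every nonempty open set at arbitrarily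
  late times. Collective convergence makes the \<open>F\<close>-orbit of \<open>w\<close> after a suitable time \<open>m\<close> shadow
  the \<open>f\<close>-orbit of \<open>ncomp F 1 m w\<close> with uniformly small error, so density transfers from the second
  orbit to the first; surjectivity makes every point of \<open>X\<close> of the form \<open>ncomp F 1 m w\<close>,
  which gives the converse.
\<close>

lemma ncomp_add: "ncomp F i (m + k) x = ncomp F (i + m) k (ncomp F i m x)"
  by (induction k) (auto simp: add.assoc)

lemma ncomp_const: "ncomp (\<lambda>_. f) i n = f ^^ n"
  by (induction n) auto

lemma ncomp_in:
  assumes "\<forall>n\<ge>1. F n \<in> X \<rightarrow> X" "i \<ge> 1" "x \<in> X"
  shows "ncomp F i n x \<in> X"
  using assms by (induction n) (auto simp: Pi_iff)

lemma ncomp_surj: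
  assumes "nads_surjective X F" "i \<ge> 1"
  shows "ncomp F i n ` X = X"
proof (induction n)
  case (Suc n)
  have "ncomp F i (Suc n) ` X = F (i + n) ` ncomp F i n ` X"
    by (simp only: ncomp.simps image_comp)
  then show ?case
    using Suc assms by (simp add: nads_surjective_def)
qed simp

text \<open>A ball about the non-isolated point \<open>y\<close> contains infinitely many points of
  \<open>X\<close>. Deleting the finitely many values \<open>u 0, ..., u (m - 1)\<close> leaves an
  open set that still meets \<open>X\<close>; density puts some \<open>u n\<close> in it, and such
  an index cannot be below \<open>m\<close>.\<close>

lemma dense_sequence_visits_late:
  fixes u :: "nat \<Rightarrow> 'a::metric_space"
  assumes iso: "\<forall>x\<in>X. \<not> x isolated_in X"
    and dense: "X \<subseteq> closure (range u)"
    and "y \<in> X" "0 < e"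
  shows "\<exists>n\<ge>m. dist (u n) y < e"
proof -
  have "y islimpt X"
    using iso \<open>y \<in> X\<close> by (simp add: isolated_in_islimpt_iff)
  then have "infinite (X \<inter> ball y e - u ` {..<m})"
    using \<open>0 < e\<close> by (simp add: islimpt_eq_infinite_ball)
  then obtain z where z: "z \<in> X" "z \<in> ball y e - u ` {..<m}"
    by (metis IntE DiffE DiffI all_not_in_conv finite.emptyI)
  have "open (ball y e - u ` {..<m})"
    by (intro open_Diff open_ball finite_imp_closed) simp
  moreover have "z \<in> closure (range u)"
    using z(1) dense by blast
  ultimately have "range u \<inter> (ball y e - u ` {..<m}) \<noteq> {}"
    using open_Int_closure_eq_empty z(2) by (metis IntI emptyE inf_commute)
  then obtain n where "u n \<in> ball y e - u ` {..<m}"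
    by blast
  then have "\<not> n < m" "dist (u n) y < e"
    by (auto simp: dist_commute)
  then show ?thesis
    by (meson not_less)
qed

text \<open>Puts minimality in a form that tolerates discarding or prepending finitely many steps of
  an orbit.\<close>

lemma nads_minimal_iff:
  assumes "\<forall>x\<in>X. \<not> x isolated_in X" and maps: "\<forall>n\<ge>1. F n \<in> X \<rightarrow> X"
  shows "nads_minimal X F \<longleftrightarrow> (\<forall>x\<in>X. \<forall>y\<in>X. \<forall>e>0. \<forall>m. \<exists>n\<ge>m. dist (ncomp F 1 n x) y < e)"
    (is "_ \<longleftrightarrow> (\<forall>x\<in>X. ?late x)")
proof -
  have "(top_of_set X) closure_of (nads_orbit F x) = X \<longleftrightarrow> ?late x" if "x \<in> X" for x
  proof -
    \<comment> \<open>Closure in the subspace is the trace on \<open>X\<close> of the closure of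
      this intersection, so it reduces to the ordinary closure of the orbit.\<close>
    have "X \<inter> nads_orbit F x = nads_orbit F x"
      using ncomp_in [of F X 1 x] maps that by (auto simp: nads_orbit_def)
    then have "(top_of_set X) closure_of (nads_orbit F x) = X \<longleftrightarrow> X \<subseteq> closure (nads_orbit F x)"
      by (auto simp: closure_of_subtopology)
    also have "\<dots> \<longleftrightarrow> ?late x"
    proof
      assume "X \<subseteq> closure (nads_orbit F x)"
      then show "?late x"
        using dense_sequence_visits_late [OF assms(1)] unfolding nads_orbit_def by blast
    next
      assume "?late x"
      then show "X \<subseteq> closure (nads_orbit F x)"
        by (fastforce simp: nads_orbit_def closure_approachable)
    qed
    finally show ?thesis .
  qed
  then show ?thesis
    by (simp add: nads_minimal_def)
qed

text \<open>The distances are bounded by the diameter of \<open>X\<close>, so the real-valued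
  \<open>SUP\<close> is a genuine upper bound.\<close>

lemma dist_le_sup_dist:
  assumes "bounded X" "g \<in> X \<rightarrow> X" "h \<in> X \<rightarrow> X" "x \<in> X"
  shows "dist (g x) (h x) \<le> sup_dist X g h"
proof -
  have "dist (g z) (h z) \<le> diameter X" if "z \<in> X" for z
    using assms that by (intro diameter_bounded_bound) auto
  then have "bdd_above ((\<lambda>z. dist (g z) (h z)) ` X)"
    by (meson bdd_aboveI2)
  then show ?thesis
    unfolding sup_dist_def using \<open>x \<in> X\<close> by (rule cSUP_upper2) auto
qed

text \<open>Take \<open>m = r - 1\<close> with \<open>r\<close> from collective convergence: after
  \<open>m\<close> steps the next map applied is \<open>F r\<close>, so \<open>ncomp F r k\<close>
  is compared with \<open>f ^^ k\<close> at the point \<open>ncomp F 1 m w\<close>. The bound is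
  uniform in \<open>k\<close> and in that point.\<close>

lemma converges_collectively_shadowing:
  assumes "bounded X" and maps: "\<forall>n\<ge>1. F n \<in> X \<rightarrow> X" and "f \<in> X \<rightarrow> X"
    and "converges_collectively X F f" "0 < e"
  shows "\<exists>m. \<forall>k\<ge>1. \<forall>w\<in>X. dist (ncomp F 1 (m + k) w) ((f ^^ k) (ncomp F 1 m w)) < e"
proof -
  obtain r where r: "r \<ge> 1" "\<And>k. k \<ge> 1 \<Longrightarrow> sup_dist X (ncomp F r k) (f ^^ k) < e"
    using assms unfolding converges_collectively_def by (meson order_refl)
  have "dist (ncomp F 1 (r - 1 + k) w) ((f ^^ k) (ncomp F 1 (r - 1) w)) < e"
    if "k \<ge> 1" "w \<in> X" for k w
  proof -
    have "ncomp F r k \<in> X \<rightarrow> X" "f ^^ k \<in> X \<rightarrow> X" "ncomp F 1 (r - 1) w \<in> X"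
      using ncomp_in [of F X] ncomp_in [of "\<lambda>_. f" X 1] maps \<open>f \<in> X \<rightarrow> X\<close> r(1) that
      by (auto simp: ncomp_const)
    then have "dist (ncomp F r k (ncomp F 1 (r - 1) w)) ((f ^^ k) (ncomp F 1 (r - 1) w)) < e"
      using dist_le_sup_dist [OF \<open>bounded X\<close>] r(2) [OF that(1)] by (blast intro: le_less_trans)
    \<comment> \<open>Since \<open>r \<ge> 1\<close>, the truncated subtraction is exact and
      \<open>1 + (r - 1) = r\<close>.\<close>
    then show ?thesis
      unfolding ncomp_add using r(1) by simp
  qed
  then show ?thesis
    by blast
qed

theorem theorem8:
  fixes X :: "'a::metric_space set"
    and F :: "nat \<Rightarrow> 'a \<Rightarrow> 'a"
    and f :: "'a \<Rightarrow> 'a"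
  assumes "\<forall>x\<in>X. \<not> x isolated_in X"
    and "nads X F"
    and "nads_feeble_open X F"
    and "nads_surjective X F"
    and "f \<in> X \<rightarrow> X"
    and "converges_uniformly X F f"
    and "converges_collectively X F f"
  shows "nads_minimal X (\<lambda>_. f) \<longleftrightarrow> nads_minimal X F"
proof -
  have bnd: "bounded X" and maps: "\<forall>n\<ge>1. F n \<in> X \<rightarrow> X"
    using assms(2) by (auto simp: nads_def compact_imp_bounded)
  note minF = nads_minimal_iff [of X F, OF assms(1) maps]
  have "\<forall>n\<ge>1::nat. f \<in> X \<rightarrow> X"
    using assms(5) by simp
  note minf = nads_minimal_iff [of X "\<lambda>_. f", OF assms(1) this, unfolded ncomp_const]
  note shadow = converges_collectively_shadowing [of X F f, OF bnd maps assms(5,7)]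
  show ?thesis
  proof
    assume min: "nads_minimal X (\<lambda>_. f)"
    have "\<exists>n\<ge>N. dist (ncomp F 1 n x) y < e" if x: "x \<in> X" and y: "y \<in> X" and e: "e > 0" for x y e N
    proof -
      obtain m where m: "\<forall>k\<ge>1. \<forall>w\<in>X.
          dist (ncomp F 1 (m + k) w) ((f ^^ k) (ncomp F 1 m w)) < e / 2"
        using shadow [OF half_gt_zero [OF e]] by blast
      have "ncomp F 1 m x \<in> X"
        by (rule ncomp_in [OF maps _ x]) simp
      \<comment> \<open>Shadowing is available only for \<open>k \<ge> 1\<close>; the bound
        \<open>N\<close> makes the time \<open>m + k\<close> late enough.\<close>
      then obtain k where k: "k \<ge> max 1 N" "dist ((f ^^ k) (ncomp F 1 m x)) y < e / 2"
        using min [unfolded minf, rule_format, OF _ y half_gt_zero [OF e]] by blast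
      have "dist (ncomp F 1 (m + k) x) y < e"
        using dist_triangle_half_r [of "(f ^^ k) (ncomp F 1 m x)"] k m [rule_format, of k x] x
        by (simp add: dist_commute)
      then show ?thesis
        using k(1) by (intro exI [of _ "m + k"]) auto
    qed
    then show "nads_minimal X F"
      unfolding minF by (intro ballI allI impI)
  next
    assume min: "nads_minimal X F"
    have "\<exists>n\<ge>N. dist ((f ^^ n) x) y < e" if x: "x \<in> X" and y: "y \<in> X" and e: "e > 0" for x y e N
    proof -
      obtain m where m: "\<forall>k\<ge>1. \<forall>w\<in>X.
          dist (ncomp F 1 (m + k) w) ((f ^^ k) (ncomp F 1 m w)) < e / 2"
        using shadow [OF half_gt_zero [OF e]] by blast
      \<comment> \<open>With this preimage, the \<open>F\<close>-orbit of \<open>w\<close> from time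
        \<open>m\<close> on shadows the \<open>f\<close>-orbit of \<open>x\<close> itself.\<close>
      obtain w where w: "w \<in> X" "ncomp F 1 m w = x"
        using ncomp_surj [OF assms(4), of 1 m] x by (metis imageE order_refl)
      \<comment> \<open>The visit must come late enough that \<open>n - m\<close> is a valid
        shadowing time and at least \<open>N\<close>; early visits of the orbit of \<open>w\<close>
        say nothing about \<open>x\<close>.\<close>
      obtain n where n: "n \<ge> m + max 1 N" "dist (ncomp F 1 n w) y < e / 2"
        using min [unfolded minF, rule_format, OF w(1) y half_gt_zero [OF e]] by blast
      define k where "k = n - m"
      with n(1) have k: "n = m + k" "k \<ge> max 1 N"
        by auto
      have "dist ((f ^^ k) x) y < e"
        using dist_triangle_half_r [of "ncomp F 1 n w"] k n m [rule_format, of k w] w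
        by (simp add: dist_commute)
      then show ?thesis
        using k(2) by auto
    qed
    then show "nads_minimal X (\<lambda>_. f)"
      unfolding minf by (intro ballI allI impI)
  qed
qed

end
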